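(* Let $\alpha=2/3$ and $\beta=1/3$. The discrete approximation $\alpha L^a_{+}+\beta L^a_{\times}$ of the quasi-Laplacian $L^a[f]=\nabla\cdot(a\nabla f)$ on the plane is asymptotically rotation-equivariant up to order $O(h^3)$ as $h\to0$. That is, writing $T_h(a,f)=\alpha L^a_{+}[f]+\beta L^a_{\times}[f]$, for all smooth functions $a,f:\mathbb{R}^2\to\mathbb{R}$, every rotation $R$ of $\mathbb{R}^2$ about the origin, and every point $p\in\mathbb{R}^2$, $$T_h(a\circ R,\,f\circ R)(p)=T_h(a,f)(Rp)+O(h^3)\qquad\text{as } h\to0 .$$
   Context: For a step-size $h>0$, smooth functions $a,f:\mathbb{R}^2\to\mathbb{R}$ and a point $p=(x,y)$ (regarded as a vertex of an axis-aligned square grid with step-size $h$), the two five-point stencils, with the coefficient $a$ evaluated at staggered (half-way) points, are $$L^a_{+}[f](x,y)=\frac1{h^2}\Big[a(x+\tfrac h2,y)f(x+h,y)+a(x-\tfrac h2,y)f(x-h,y)+a(x,y+\tfrac h2)f(x,y+h)+a(x,y-\tfrac h2)f(x,y-h)$$ $$\qquad-\big(a(x+\tfrac h2,y)+a(x-\tfrac h2,y)+a(x,y+\tfrac h2)+a(x,y-\tfrac h2)\big)f(x,y)\Big],$$ $$L^a_{\times}[f](x,y)=\frac1{2h^2}\sum_{\sigma,\tau\in\{+1,-1\}}a\big(x+\tfrac{\sigma h}2,y+\tfrac{\tau h}2\big)\Big[f(x+\sigma h,y+\tau h)-f(x,y)\Big].$$ The constant in $O(h^3)$ may depend on $a$,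 $f$, $R$ and $p$. *)

theory Defs
  imports "HOL-Analysis.Analysis" "HOL-Library.Landau_Symbols"
begin

text \<open>\<open>C_diff k f\<close>: \<open>f\<close> is of class \<open>C\<^sup>k\<close> on the whole space. Since the domain is
  finite-dimensional, continuity of all iterated directional derivatives \<open>\<partial>\<^sub>v\<close> up to
  order \<open>k\<close> is the same as continuity of the iterated total derivatives.\<close>

primrec C_diff :: "nat \<Rightarrow> ('a::euclidean_space \<Rightarrow> 'b::real_normed_vector) \<Rightarrow> bool" where
  "C_diff 0 f \<longleftrightarrow> continuous_on UNIV f"
| "C_diff (Suc k) f \<longleftrightarrow>
     (\<forall>x. f differentiable (at x)) \<and> (\<forall>v. C_diff k (\<lambda>x. frechet_derivative f (at x) v))"

definition smooth :: "('a::euclidean_space \<Rightarrow> 'b::real_normed_vector) \<Rightarrow> bool" where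
  "smooth f \<longleftrightarrow> (\<forall>k. C_diff k f)"

definition L_plus :: "real \<Rightarrow> (real^2 \<Rightarrow> real) \<Rightarrow> (real^2 \<Rightarrow> real) \<Rightarrow> real^2 \<Rightarrow> real" where
  "L_plus h a f p = (let x = p $ 1; y = p $ 2 in
     1 / h^2 *
       (a (vector [x + h/2, y]) * f (vector [x + h, y])
      + a (vector [x - h/2, y]) * f (vector [x - h, y])
      + a (vector [x, y + h/2]) * f (vector [x, y + h])
      + a (vector [x, y - h/2]) * f (vector [x, y - h])
      - (a (vector [x + h/2, y]) + a (vector [x - h/2, y])
         + a (vector [x, y + h/2]) + a (vector [x, y - h/2])) * f (vector [x, y])))"

definition L_times :: "real \<Rightarrow> (real^2 \<Rightarrow> real) \<Rightarrow> (real^2 \<Rightarrow> real) \<Rightarrow> real^2 \<Rightarrow> real" where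
  "L_times h a f p = (let x = p $ 1; y = p $ 2 in
     1 / (2 * h^2) *
       (\<Sum>\<sigma>\<in>{1, -1}. \<Sum>\<tau>\<in>{1, -1}.
          a (vector [x + \<sigma> * h / 2, y + \<tau> * h / 2])
            * (f (vector [x + \<sigma> * h, y + \<tau> * h]) - f (vector [x, y]))))"

definition T_stencil ::
    "real \<Rightarrow> real \<Rightarrow> real \<Rightarrow> (real^2 \<Rightarrow> real) \<Rightarrow> (real^2 \<Rightarrow> real) \<Rightarrow> real^2 \<Rightarrow> real" where
  "T_stencil \<alpha> \<beta> h a f p = \<alpha> * L_plus h a f p + \<beta> * L_times h a f p"

end

theory Submission imports Defs begin

text \<open>
  Precomposing both fields with \<open>R\<close> amounts to turning the stencil. Put \<open>q = R p\<close> and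
  \<open>\<Phi> w = a (q + w/2) (f (q + w) - f q)\<close>, a single smooth function. Then \<open>h\<^sup>2\<close> times the stencil
  applied to \<open>(a \<circ> R, f \<circ> R)\<close> at \<open>p\<close> is a fixed weighted sum of \<open>\<Phi>\<close> over the eight vectors
  \<open>\<plusminus>hu\<close>, \<open>\<plusminus>hv\<close>, \<open>\<plusminus>hu \<plusminus> hv\<close>, where \<open>u\<close> and \<open>v\<close> are the columns of \<open>R\<close>
  (\<open>T_stencil_eq_frame_sum\<close>); the unrotated stencil at \<open>q\<close> is the same sum of the same \<open>\<Phi>\<close> for
  the standard frame. So the question is how far such a sum depends on the orthonormal frame.

  Along each ray, \<open>\<Phi> (h w)\<close> has a Taylor expansion in \<open>h\<close> (\<open>smooth_ray_taylor\<close>), and its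
  coefficient of order \<open>k\<close> is a homogeneous polynomial of degree \<open>k\<close> in the direction \<open>w\<close>
  (\<open>binary_form_iterated_dir_deriv\<close>). The ratio of the weights \<open>2/3\<close> and \<open>1/3\<close> is the one that makes
  the eight-point sum independent of the frame on homogeneous polynomials of degree less than six
  (\<open>frame_sum_isotropic\<close>): odd degrees cancel by central symmetry, and for a linear form
  \<open>w \<mapsto> \<xi> \<bullet> w\<close> the sums of its square and its fourth power are \<open>2 \<bar>\<xi>\<bar>\<^sup>2\<close> and \<open>2 \<bar>\<xi>\<bar>\<^sup>4\<close>. Powers of
  linear forms span all homogeneous polynomials, so this settles degrees two and four. Hence the
  Taylor polynomials of degree four contribute equally for both frames; what remains is
  \<open>O(h\<^sup>5)\<close>, and division by \<open>h\<^sup>2\<close> leaves \<open>O(h\<^sup>3)\<close>.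
\<close>

section \<open>Smooth functions\<close>

definition dir_deriv ::
    "'a::euclidean_space \<Rightarrow> ('a \<Rightarrow> 'b::real_normed_vector) \<Rightarrow> 'a \<Rightarrow> 'b" where
  "dir_deriv v f = (\<lambda>x. frechet_derivative f (at x) v)"

lemma dir_deriv_eqI:
  assumes "\<And>x. (f has_derivative f' x) (at x)"
  shows "dir_deriv v f = (\<lambda>x. f' x v)"
  unfolding dir_deriv_def using assms frechet_derivative_at by metis

lemma C_diff_Suc_iff:
  "C_diff (Suc k) f \<longleftrightarrow> (\<forall>x. f differentiable (at x)) \<and> (\<forall>v. C_diff k (dir_deriv v f))"
  by (simp add: dir_deriv_def)

text \<open>Exhibiting any family of derivatives avoids computing with the choice operator behind
  \<open>frechet_derivative\<close>; the closure properties below rest on this rule.\<close>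

lemma C_diff_SucI:
  assumes "\<And>x. (f has_derivative f' x) (at x)" and "\<And>v. C_diff k (\<lambda>x. f' x v)"
  shows "C_diff (Suc k) f"
  unfolding C_diff_Suc_iff
  using assms dir_deriv_eqI[of f f'] by (auto simp: differentiable_def)

lemma has_derivative_dir_deriv:
  assumes "f differentiable (at x)"
  shows "(f has_derivative (\<lambda>v. dir_deriv v f x)) (at x)"
  using assms by (simp add: dir_deriv_def frechet_derivative_works)

lemma C_diff_SucD: "C_diff (Suc k) f \<Longrightarrow> C_diff k f"
proof (induction k arbitrary: f)
  case 0
  then show ?case
    by (auto simp: continuous_on_eq_continuous_at differentiable_imp_continuous_within)
next
  case (Suc k)
  then show ?case unfolding C_diff_Suc_iff[of "Suc k"] C_diff_Suc_iff[of k f] by blast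
qed

lemma C_diff_const: "C_diff k (\<lambda>x. c)"
  by (induction k arbitrary: c) (auto intro: C_diff_SucI[where f' = "\<lambda>_ _. 0"] simp del: C_diff.simps(2))

lemma C_diff_add: "C_diff k f \<Longrightarrow> C_diff k g \<Longrightarrow> C_diff k (\<lambda>x. f x + g x)"
proof (induction k arbitrary: f g)
  case 0
  then show ?case by (simp add: continuous_on_add)
next
  case (Suc k)
  show ?case
  proof (rule C_diff_SucI)
    show "((\<lambda>x. f x + g x) has_derivative (\<lambda>v. dir_deriv v f x + dir_deriv v g x)) (at x)" for x
      using Suc.prems unfolding C_diff_Suc_iff
      by (auto intro!: has_derivative_add has_derivative_dir_deriv)
  qed (use Suc in \<open>auto simp: C_diff_Suc_iff simp del: C_diff.simps(2)\<close>)
qed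

lemma C_diff_mult:
  fixes f g :: "'a::euclidean_space \<Rightarrow> real"
  shows "C_diff k f \<Longrightarrow> C_diff k g \<Longrightarrow> C_diff k (\<lambda>x. f x * g x)"
proof (induction k arbitrary: f g)
  case 0
  then show ?case by (simp add: continuous_on_mult)
next
  case (Suc k)
  show ?case
  proof (rule C_diff_SucI)
    show "((\<lambda>x. f x * g x) has_derivative
            (\<lambda>v. f x * dir_deriv v g x + dir_deriv v f x * g x)) (at x)" for x
      using Suc.prems unfolding C_diff_Suc_iff
      by (auto intro!: has_derivative_mult has_derivative_dir_deriv)
    show "C_diff k (\<lambda>x. f x * dir_deriv v g x + dir_deriv v f x * g x)" for v
      using Suc.prems[THEN C_diff_SucD] Suc.prems Suc.IH
      by (auto intro!: C_diff_add simp: C_diff_Suc_iff simp del: C_diff.simps(2))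
  qed
qed

lemma C_diff_affine:
  fixes f :: "'a::euclidean_space \<Rightarrow> real"
  shows "C_diff k f \<Longrightarrow> C_diff k (\<lambda>x. f (q + c *\<^sub>R x))"
proof (induction k arbitrary: f)
  case 0
  then have "continuous_on UNIV f" by simp
  then have "continuous_on UNIV (\<lambda>x. f (q + c *\<^sub>R x))"
    by (rule continuous_on_compose2) (auto intro!: continuous_intros)
  then show ?case by simp
next
  case (Suc k)
  have f: "f differentiable (at x)" "C_diff k (dir_deriv v f)" for x v
    using Suc.prems unfolding C_diff_Suc_iff by auto
  show ?case
  proof (rule C_diff_SucI)
    show "((\<lambda>x. f (q + c *\<^sub>R x)) has_derivative
            (\<lambda>v. c * dir_deriv v f (q + c *\<^sub>R x))) (at x)" for x
    proof -
      have 1: "((\<lambda>x. q + c *\<^sub>R x) has_derivative (\<lambda>v. c *\<^sub>R v)) (at x)"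
        by (auto intro!: derivative_eq_intros)
      note D = has_derivative_dir_deriv[OF f(1), of "q + c *\<^sub>R x"]
      have "((\<lambda>x. f (q + c *\<^sub>R x)) has_derivative (\<lambda>v. dir_deriv (c *\<^sub>R v) f (q + c *\<^sub>R x))) (at x)"
        using has_derivative_compose[OF 1 D] .
      moreover have "dir_deriv (c *\<^sub>R v) f (q + c *\<^sub>R x) = c * dir_deriv v f (q + c *\<^sub>R x)" for v
        using linear_scale[OF has_derivative_linear[OF D]] by simp
      ultimately show ?thesis by simp
    qed
    show "C_diff k (\<lambda>x. c * dir_deriv v f (q + c *\<^sub>R x))" for v
      using Suc.IH[OF f(2)] C_diff_const by (rule C_diff_mult[rotated])
  qed
qed

lemma smooth_differentiable: "smooth f \<Longrightarrow> f differentiable (at x)"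
  unfolding smooth_def using C_diff_Suc_iff by blast

lemma smooth_dir_deriv: "smooth f \<Longrightarrow> smooth (dir_deriv v f)"
  unfolding smooth_def using C_diff_Suc_iff by blast

lemma smooth_iterated_dir_deriv: "smooth f \<Longrightarrow> smooth ((dir_deriv v ^^ k) f)"
  by (induction k) (auto intro: smooth_dir_deriv)

section \<open>Taylor expansion along rays\<close>

text \<open>The restriction of \<open>f\<close> to the ray through \<open>u\<close> has \<open>k\<close>-th derivative
  \<open>t \<mapsto> (dir_deriv u ^^ k) f (t u)\<close>. The Lagrange remainder is \<open>O(h\<^sup>n)\<close> because the \<open>n\<close>-th of
  these functions is continuous, hence bounded, on the unit interval.\<close>

lemma smooth_ray_taylor:
  fixes f :: "'a::euclidean_space \<Rightarrow> real"
  assumes "smooth f"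
  shows "(\<lambda>h. f (h *\<^sub>R u) - (\<Sum>k<n. h ^ k / fact k * (dir_deriv u ^^ k) f 0))
           \<in> O[at_right 0](\<lambda>h. h ^ n)"
proof -
  define D where "D k t = (dir_deriv u ^^ k) f (t *\<^sub>R u)" for k t
  have deriv: "(D k has_real_derivative D (Suc k) t) (at t)" for k t
  proof -
    let ?g = "(dir_deriv u ^^ k) f"
    have 1: "((\<lambda>t. t *\<^sub>R u) has_derivative (\<lambda>s. s *\<^sub>R u)) (at t)"
      by (auto intro!: derivative_eq_intros)
    note d = has_derivative_dir_deriv[OF smooth_differentiable
        [OF smooth_iterated_dir_deriv[OF assms]], of k u "t *\<^sub>R u"]
    have "(D k has_derivative (\<lambda>s. dir_deriv (s *\<^sub>R u) ?g (t *\<^sub>R u))) (at t)"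
      unfolding D_def using has_derivative_compose[OF 1 d] .
    moreover have "dir_deriv (s *\<^sub>R u) ?g (t *\<^sub>R u) = D (Suc k) t * s" for s
      using linear_scale[OF has_derivative_linear[OF d]] by (simp add: D_def)
    ultimately show ?thesis by (simp add: has_field_derivative_def)
  qed
  have "continuous_on {0..1} (D n)"
    using deriv by (intro continuous_at_imp_continuous_on) (auto intro: DERIV_isCont)
  then have "bounded (D n ` {0..1})"
    by (intro compact_imp_bounded compact_continuous_image) auto
  then obtain B where B: "\<forall>t\<in>{0..1}. \<bar>D n t\<bar> \<le> B"
    unfolding bounded_iff by auto
  show ?thesis
  proof (rule bigoI)
    have "eventually (\<lambda>h::real. h \<in> {0<..<1}) (at_right 0)"
      by (rule eventually_at_right_real) simp
    then show "\<forall>\<^sub>F h in at_right 0.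
        norm (f (h *\<^sub>R u) - (\<Sum>k<n. h ^ k / fact k * (dir_deriv u ^^ k) f 0))
          \<le> (B / fact n) * norm (h ^ n)"
    proof eventually_elim
      case (elim h)
      obtain t where t: "\<bar>t\<bar> \<le> \<bar>h\<bar>" "0 \<le> t"
        and eq: "D 0 h = (\<Sum>k<n. D k 0 / fact k * h ^ k) + D n t / fact n * h ^ n"
        using Maclaurin2[of h D "D 0" n] deriv elim by force
      have "f (h *\<^sub>R u) - (\<Sum>k<n. h ^ k / fact k * (dir_deriv u ^^ k) f 0)
              = D n t / fact n * h ^ n"
        using eq by (simp add: D_def mult.commute)
      moreover have "\<bar>D n t\<bar> \<le> B" using B t elim by simp
      ultimately show ?case
        by (simp add: abs_mult divide_right_mono mult_right_mono)
    qed
  qed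
qed

section \<open>Directional derivatives as binary forms\<close>

definition binary_form :: "nat \<Rightarrow> (real^2 \<Rightarrow> real) \<Rightarrow> bool" where
  "binary_form k Q \<longleftrightarrow> (\<exists>c. \<forall>u. Q u = (\<Sum>i\<le>k. c i * (u $ 1) ^ (k - i) * (u $ 2) ^ i))"

lemma binary_form_Suc:
  assumes "binary_form k Q1" "binary_form k Q2"
  shows "binary_form (Suc k) (\<lambda>u. u $ 1 * Q1 u + u $ 2 * Q2 u)"
proof -
  obtain c d where c: "\<And>u. Q1 u = (\<Sum>i\<le>k. c i * (u $ 1) ^ (k - i) * (u $ 2) ^ i)"
    and d: "\<And>u. Q2 u = (\<Sum>i\<le>k. d i * (u $ 1) ^ (k - i) * (u $ 2) ^ i)"
    using assms unfolding binary_form_def by blast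
  \<comment> \<open>Multiplication by \<open>u $ 1\<close> keeps the index of a coefficient, multiplication by \<open>u $ 2\<close>
    shifts it by one.\<close>
  let ?c = "\<lambda>i. if i \<le> k then c i else 0"
  let ?d = "\<lambda>i. case i of 0 \<Rightarrow> 0 | Suc j \<Rightarrow> d j"
  have 1: "u $ 1 * Q1 u = (\<Sum>i\<le>Suc k. ?c i * (u $ 1) ^ (Suc k - i) * (u $ 2) ^ i)" for u
    unfolding c by (auto simp: sum_distrib_left Suc_diff_le intro!: sum.cong)
  have 2: "u $ 2 * Q2 u = (\<Sum>i\<le>Suc k. ?d i * (u $ 1) ^ (Suc k - i) * (u $ 2) ^ i)" for u
    unfolding d sum.atMost_Suc_shift by (auto simp: sum_distrib_left intro!: sum.cong)
  have "u $ 1 * Q1 u + u $ 2 * Q2 u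
          = (\<Sum>i\<le>Suc k. (?c i + ?d i) * (u $ 1) ^ (Suc k - i) * (u $ 2) ^ i)" for u
    unfolding 1 2 sum.distrib[symmetric] by (intro sum.cong refl) (simp add: distrib_right)
  then show ?thesis unfolding binary_form_def by (intro exI allI)
qed

lemma dir_deriv_lincomb:
  fixes f g :: "'a::euclidean_space \<Rightarrow> real"
  assumes "smooth f" "smooth g"
  shows "dir_deriv u (\<lambda>x. r * f x + s * g x) = (\<lambda>x. r * dir_deriv u f x + s * dir_deriv u g x)"
proof (rule dir_deriv_eqI)
  show "((\<lambda>x. r * f x + s * g x) has_derivative
          (\<lambda>u. r * dir_deriv u f x + s * dir_deriv u g x)) (at x)" for x
    by (intro has_derivative_add has_derivative_mult_right
        has_derivative_dir_deriv smooth_differentiable assms)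
qed

lemma iterated_dir_deriv_lincomb:
  fixes f g :: "'a::euclidean_space \<Rightarrow> real"
  assumes "smooth f" "smooth g"
  shows "(dir_deriv u ^^ k) (\<lambda>x. r * f x + s * g x)
           = (\<lambda>x. r * (dir_deriv u ^^ k) f x + s * (dir_deriv u ^^ k) g x)"
  by (induction k) (simp_all add: dir_deriv_lincomb smooth_iterated_dir_deriv assms)

text \<open>Linearity of the derivative at each point turns an arbitrary direction into a combination of
  the two axes whose coefficients do not depend on the point; hence further differentiation
  passes through them.\<close>

lemma dir_deriv_axes:
  fixes f :: "real^2 \<Rightarrow> real"
  assumes "smooth f"
  shows "dir_deriv u f = (\<lambda>x. u $ 1 * dir_deriv (axis 1 1) f x + u $ 2 * dir_deriv (axis 2 1) f x)"
proof
  fix x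
  have lin: "linear (\<lambda>v. dir_deriv v f x)"
    by (intro has_derivative_linear[OF has_derivative_dir_deriv] smooth_differentiable assms)
  have "u = u $ 1 *\<^sub>R axis 1 1 + u $ 2 *\<^sub>R axis 2 1"
    by (simp add: vec_eq_iff forall_2 axis_def)
  then have "dir_deriv u f x = dir_deriv (u $ 1 *\<^sub>R axis 1 1 + u $ 2 *\<^sub>R axis 2 1) f x"
    by simp
  then show "dir_deriv u f x
      = u $ 1 * dir_deriv (axis 1 1) f x + u $ 2 * dir_deriv (axis 2 1) f x"
    by (simp add: linear_add[OF lin] linear_scale[OF lin])
qed

text \<open>Peeling off the innermost derivative leaves the \<open>k\<close>-fold derivative, in the same direction
  \<open>u\<close>, of the two partial derivatives of \<open>f\<close>. The induction therefore runs over all smooth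
  functions at once.\<close>

lemma binary_form_iterated_dir_deriv:
  assumes "smooth f"
  shows "binary_form k (\<lambda>u. (dir_deriv u ^^ k) f x)"
  using assms
proof (induction k arbitrary: f)
  case 0
  show ?case by (auto simp: binary_form_def)
next
  case (Suc k)
  have "(dir_deriv u ^^ Suc k) f x = u $ 1 * (dir_deriv u ^^ k) (dir_deriv (axis 1 1) f) x
          + u $ 2 * (dir_deriv u ^^ k) (dir_deriv (axis 2 1) f) x" for u
    unfolding funpow_Suc_right comp_apply dir_deriv_axes[OF Suc.prems, of u]
    by (simp add: iterated_dir_deriv_lincomb smooth_dir_deriv Suc.prems)
  then show ?case
    using binary_form_Suc[OF Suc.IH Suc.IH] smooth_dir_deriv[OF Suc.prems] by simp
qed

section \<open>Isotropy of the weighted eight-point sum\<close>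

text \<open>The weight \<open>1/6\<close> of the diagonal directions is \<open>\<beta>/2\<close> for \<open>\<beta> = 1/3\<close>: the diagonal stencil
  carries the prefactor \<open>1/(2h\<^sup>2)\<close>, the axis-parallel one \<open>1/h\<^sup>2\<close>.\<close>

definition frame_sum :: "(real^2 \<Rightarrow> real) \<Rightarrow> real^2 \<Rightarrow> real^2 \<Rightarrow> real" where
  "frame_sum \<phi> u v =
     2/3 * (\<phi> u + \<phi> (- u) + \<phi> v + \<phi> (- v))
   + 1/6 * (\<phi> (u + v) + \<phi> (u - v) + \<phi> (- u + v) + \<phi> (- u - v))"

lemma frame_sum_bigo:
  assumes "\<And>w. (\<lambda>h. \<phi> h w) \<in> O[F](g)"
  shows "(\<lambda>h. frame_sum (\<phi> h) u v) \<in> O[F](g)"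
  unfolding frame_sum_def using assms
  by (intro sum_in_bigo landau_o.big.cmult_in_iff[THEN iffD2] disjI2) simp_all

lemma frame_sum_add: "frame_sum (\<lambda>w. \<phi> w + \<psi> w) u v = frame_sum \<phi> u v + frame_sum \<psi> u v"
  by (simp add: frame_sum_def algebra_simps)

lemma frame_sum_diff: "frame_sum (\<lambda>w. \<phi> w - \<psi> w) u v = frame_sum \<phi> u v - frame_sum \<psi> u v"
  by (simp add: frame_sum_def algebra_simps)

lemma frame_sum_cmult: "frame_sum (\<lambda>w. c * \<phi> w) u v = c * frame_sum \<phi> u v"
  by (simp add: frame_sum_def algebra_simps)

lemma frame_sum_sum: "frame_sum (\<lambda>w. \<Sum>i\<in>A. \<phi> i w) u v = (\<Sum>i\<in>A. frame_sum (\<phi> i) u v)"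
  by (simp only: frame_sum_def sum.distrib flip: sum_distrib_left)

text \<open>The values depend only on the inner products of the rows of the matrix with columns \<open>u\<close> and
  \<open>v\<close>. Up to binomial factors they are the coefficients, in \<open>\<xi>\<close>, of
  \<open>2 ((\<xi> \<bullet> u)\<^sup>2 + (\<xi> \<bullet> v)\<^sup>2)\<close>, which is the sum of the square of the linear form \<open>w \<mapsto> \<xi> \<bullet> w\<close>.\<close>

lemma frame_sum_quadratic_moments:
  "frame_sum (\<lambda>w. (w $ 1)\<^sup>2) u v = 2 * ((u $ 1)\<^sup>2 + (v $ 1)\<^sup>2)"
  "frame_sum (\<lambda>w. w $ 1 * w $ 2) u v = 2 * (u $ 1 * u $ 2 + v $ 1 * v $ 2)"
  "frame_sum (\<lambda>w. (w $ 2)\<^sup>2) u v = 2 * ((u $ 2)\<^sup>2 + (v $ 2)\<^sup>2)"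
  by (simp_all only: frame_sum_def vector_add_component vector_minus_component
      vector_uminus_component) algebra+

text \<open>With \<open>x = \<xi> \<bullet> u\<close> and \<open>y = \<xi> \<bullet> v\<close>, the fourth power of the linear form \<open>w \<mapsto> \<xi> \<bullet> w\<close> sums to
  \<open>4/3 (x\<^sup>4 + y\<^sup>4) + 1/3 ((x + y)\<^sup>4 + (x - y)\<^sup>4) = 2 (x\<^sup>2 + y\<^sup>2)\<^sup>2\<close>. The ratio \<open>2 : 1\<close> of the weights
  of the two stencils is what produces a perfect square here. The five formulas are the
  coefficients of this identity in \<open>\<xi>\<close>, divided by binomial factors.\<close>

lemma frame_sum_quartic_moments:
  "frame_sum (\<lambda>w. (w $ 1)^4) u v = 2 * ((u $ 1)\<^sup>2 + (v $ 1)\<^sup>2)\<^sup>2"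
  "frame_sum (\<lambda>w. (w $ 1)^3 * w $ 2) u v
     = 2 * ((u $ 1)\<^sup>2 + (v $ 1)\<^sup>2) * (u $ 1 * u $ 2 + v $ 1 * v $ 2)"
  "frame_sum (\<lambda>w. (w $ 1)\<^sup>2 * (w $ 2)\<^sup>2) u v
     = 2/3 * (((u $ 1)\<^sup>2 + (v $ 1)\<^sup>2) * ((u $ 2)\<^sup>2 + (v $ 2)\<^sup>2)
              + 2 * (u $ 1 * u $ 2 + v $ 1 * v $ 2)\<^sup>2)"
  "frame_sum (\<lambda>w. w $ 1 * (w $ 2)^3) u v
     = 2 * ((u $ 2)\<^sup>2 + (v $ 2)\<^sup>2) * (u $ 1 * u $ 2 + v $ 1 * v $ 2)"
  "frame_sum (\<lambda>w. (w $ 2)^4) u v = 2 * ((u $ 2)\<^sup>2 + (v $ 2)\<^sup>2)\<^sup>2"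
  by (simp_all only: frame_sum_def vector_add_component vector_minus_component
      vector_uminus_component) algebra+

lemma binary_form_minus:
  assumes "binary_form k Q"
  shows "Q (- u) = (- 1) ^ k * Q u"
proof -
  obtain c where c: "\<And>u. Q u = (\<Sum>i\<le>k. c i * (u $ 1) ^ (k - i) * (u $ 2) ^ i)"
    using assms unfolding binary_form_def by blast
  have "c i * ((- u) $ 1) ^ (k - i) * ((- u) $ 2) ^ i
      = (- 1) ^ k * (c i * (u $ 1) ^ (k - i) * (u $ 2) ^ i)" if "i \<le> k" for i
  proof -
    have "(- 1 :: real) ^ k = (- 1) ^ (k - i) * (- 1) ^ i"
      using that by (simp flip: power_add)
    then show ?thesis
      by (simp add: power_minus[of "u $ 1"] power_minus[of "u $ 2"])
  qed
  then show ?thesis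
    unfolding c sum_distrib_left by (intro sum.cong) auto
qed

text \<open>The moments involve only inner products of the rows of \<open>R\<close>, and these are \<open>0\<close> or \<open>1\<close> for
  every orthogonal matrix. In odd degree, opposite directions cancel.\<close>

lemma frame_sum_isotropic:
  assumes "binary_form k Q" and "k < 6"
  obtains m where
    "\<And>R :: real^2^2. orthogonal_matrix R \<Longrightarrow> frame_sum Q (column 1 R) (column 2 R) = m"
proof -
  obtain c where c: "\<And>u. Q u = (\<Sum>i\<le>k. c i * (u $ 1) ^ (k - i) * (u $ 2) ^ i)"
    using assms(1) unfolding binary_form_def by blast
  have rows: "(R $ 1 $ 1)\<^sup>2 + (R $ 1 $ 2)\<^sup>2 = 1" "(R $ 2 $ 1)\<^sup>2 + (R $ 2 $ 2)\<^sup>2 = 1"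
      "R $ 1 $ 1 * R $ 2 $ 1 + R $ 1 $ 2 * R $ 2 $ 2 = 0"
    if "orthogonal_matrix R" for R :: "real^2^2"
  proof -
    have "R ** transpose R = mat 1"
      using that by (simp add: orthogonal_matrix_def)
    then show "(R $ 1 $ 1)\<^sup>2 + (R $ 1 $ 2)\<^sup>2 = 1" "(R $ 2 $ 1)\<^sup>2 + (R $ 2 $ 2)\<^sup>2 = 1"
        "R $ 1 $ 1 * R $ 2 $ 1 + R $ 1 $ 2 * R $ 2 $ 2 = 0"
      by (simp_all add: vec_eq_iff forall_2 matrix_matrix_mult_def sum_2 transpose_def mat_def
          power2_eq_square)
  qed
  consider "odd k" | "k = 0" | "k = 2" | "k = 4" using assms(2) by fastforce
  then show ?thesis
  proof cases
    case 1
    have "frame_sum Q u v = 0" for u v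
      using 1 binary_form_minus[OF assms(1), of u] binary_form_minus[OF assms(1), of v]
        binary_form_minus[OF assms(1), of "u + v"] binary_form_minus[OF assms(1), of "u - v"]
      by (simp add: frame_sum_def)
    then show ?thesis by (rule that)
  next
    case 2
    show ?thesis
      by (rule that[of "10 / 3 * c 0"]) (simp add: frame_sum_def c 2)
  next
    case 3
    then have Q: "Q = (\<lambda>u. c 0 * (u $ 1)\<^sup>2 + c 1 * (u $ 1 * u $ 2) + c 2 * (u $ 2)\<^sup>2)"
      by (simp add: fun_eq_iff c eval_nat_numeral)
    show ?thesis
      by (rule that[of "2 * c 0 + 2 * c 2"])
        (simp add: Q frame_sum_add frame_sum_cmult frame_sum_quadratic_moments column_def rows)
  next
    case 4
    then have Q: "Q = (\<lambda>u. c 0 * (u $ 1)^4 + c 1 * ((u $ 1)^3 * u $ 2)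
                        + c 2 * ((u $ 1)\<^sup>2 * (u $ 2)\<^sup>2)
                        + c 3 * (u $ 1 * (u $ 2)^3) + c 4 * (u $ 2)^4)"
      by (simp add: fun_eq_iff c eval_nat_numeral)
    show ?thesis
      by (rule that[of "2 * c 0 + 2/3 * c 2 + 2 * c 4"])
        (simp add: Q frame_sum_add frame_sum_cmult frame_sum_quartic_moments column_def rows)
  qed
qed

section \<open>The stencil as a frame sum\<close>

text \<open>The contribution to the stencil at \<open>q\<close> of the neighbour \<open>q + w\<close>, with the coefficient taken at
  the midpoint.\<close>

definition flux :: "(real^2 \<Rightarrow> real) \<Rightarrow> (real^2 \<Rightarrow> real) \<Rightarrow> real^2 \<Rightarrow> real^2 \<Rightarrow> real" where
  "flux a f q w = a (q + (1/2) *\<^sub>R w) * (f (q + w) - f q)"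

lemma smooth_flux:
  assumes "smooth a" "smooth f"
  shows "smooth (flux a f q)"
proof -
  have "C_diff k (\<lambda>w. a (q + (1/2) *\<^sub>R w) * (f (q + 1 *\<^sub>R w) + - f q))" for k
    using assms unfolding smooth_def
    by (intro C_diff_mult C_diff_add C_diff_affine[where f = a] C_diff_affine[where f = f]
        C_diff_const) simp_all
  then show ?thesis by (simp add: smooth_def flux_def[abs_def])
qed

text \<open>A linear map carries the grid around \<open>p\<close>, midpoints included, to the grid around \<open>R p\<close> spanned
  by the columns of \<open>R\<close>. For \<open>R = mat 1\<close> this is the description of the original stencil.\<close>

lemma T_stencil_eq_frame_sum:
  "T_stencil (2/3) (1/3) h (a \<circ> (*v) R) (f \<circ> (*v) R) p
     = frame_sum (\<lambda>w. flux a f (R *v p) (h *\<^sub>R w)) (column 1 R) (column 2 R) / h\<^sup>2"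
proof -
  have R: "R *v vector [p $ 1 + s, p $ 2] = R *v p + s *\<^sub>R column 1 R"
    "R *v vector [p $ 1 - s, p $ 2] = R *v p - s *\<^sub>R column 1 R"
    "R *v vector [p $ 1, p $ 2 + s] = R *v p + s *\<^sub>R column 2 R"
    "R *v vector [p $ 1, p $ 2 - s] = R *v p - s *\<^sub>R column 2 R"
    "R *v vector [p $ 1, p $ 2] = R *v p"
    "R *v vector [p $ 1 + s, p $ 2 - t] = R *v p + (s *\<^sub>R column 1 R - t *\<^sub>R column 2 R)"
    "R *v vector [p $ 1 - s, p $ 2 + t] = R *v p + (t *\<^sub>R column 2 R - s *\<^sub>R column 1 R)"
    "R *v vector [p $ 1 - s, p $ 2 - t] = R *v p - (s *\<^sub>R column 1 R + t *\<^sub>R column 2 R)"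
    "R *v vector [p $ 1 + s, p $ 2 + t] = R *v p + (s *\<^sub>R column 1 R + t *\<^sub>R column 2 R)"
    for s t
    by (simp_all add: vec_eq_iff forall_2 matrix_vector_mult_def sum_2 column_def algebra_simps)
  show ?thesis
    unfolding T_stencil_def L_plus_def L_times_def Let_def frame_sum_def flux_def
    by (simp add: R) (simp add: algebra_simps add_divide_distrib diff_divide_distrib)
qed

theorem proposition3p3:
  fixes \<alpha> \<beta> :: real
    and a f :: "real^2 \<Rightarrow> real"
    and R :: "real^2^2"
    and p :: "real^2"
  assumes "\<alpha> = 2/3" and "\<beta> = 1/3"
    and "smooth a" and "smooth f"
    and "rotation_matrix R"
  shows "(\<lambda>h. T_stencil \<alpha> \<beta> h (a \<circ> (*v) R) (f \<circ> (*v) R) p - T_stencil \<alpha> \<beta> h a f (R *v p))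
           \<in> O[at_right 0](\<lambda>h. h^3)"
proof -
  define \<Phi> where "\<Phi> = flux a f (R *v p)"
  \<comment> \<open>\<open>P h\<close> is the Taylor polynomial of degree four of \<open>\<Phi>\<close> at \<open>h w\<close>, as a function of \<open>w\<close>;
    \<open>D h\<close> compares the two frames on the remainder only.\<close>
  define P where "P h u = (\<Sum>k<5. h ^ k / fact k * (dir_deriv u ^^ k) \<Phi> 0)" for h u
  define D where "D h = frame_sum (\<lambda>w. \<Phi> (h *\<^sub>R w) - P h w) (column 1 R) (column 2 R)
      - frame_sum (\<lambda>w. \<Phi> (h *\<^sub>R w) - P h w) (column 1 (mat 1)) (column 2 (mat 1))" for h
  have smooth: "smooth \<Phi>" unfolding \<Phi>_def by (rule smooth_flux) fact+
  have orth: "orthogonal_matrix R" using assms(5) by (simp add: rotation_matrix_def)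
  have remainder: "(\<lambda>h. \<Phi> (h *\<^sub>R w) - P h w) \<in> O[at_right 0](\<lambda>h. h ^ 5)" for w
    unfolding P_def by (rule smooth_ray_taylor[OF smooth])
  have D_small: "D \<in> O[at_right 0](\<lambda>h. h ^ 5)"
    unfolding D_def by (rule sum_in_bigo(2); rule frame_sum_bigo; rule remainder)
  have "frame_sum (\<lambda>u. (dir_deriv u ^^ k) \<Phi> 0) (column 1 R) (column 2 R)
      = frame_sum (\<lambda>u. (dir_deriv u ^^ k) \<Phi> 0) (column 1 (mat 1)) (column 2 (mat 1))"
    if "k < 5" for k
  proof -
    have "k < 6" using that by simp
    from frame_sum_isotropic[OF binary_form_iterated_dir_deriv[OF smooth] this] orth
    show ?thesis by (metis orthogonal_matrix_id)
  qed
  then have "frame_sum (P h) (column 1 R) (column 2 R)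
      = frame_sum (P h) (column 1 (mat 1)) (column 2 (mat 1))" for h
    unfolding P_def frame_sum_sum frame_sum_cmult by (intro sum.cong) simp_all
  \<comment> \<open>The Taylor polynomials cancel, so \<open>D\<close> is also the difference of the full sums.\<close>
  then have D: "D h = frame_sum (\<lambda>w. \<Phi> (h *\<^sub>R w)) (column 1 R) (column 2 R)
                 - frame_sum (\<lambda>w. \<Phi> (h *\<^sub>R w)) (column 1 (mat 1)) (column 2 (mat 1))" for h
    by (simp add: D_def frame_sum_diff)
  have "T_stencil \<alpha> \<beta> h (a \<circ> (*v) R) (f \<circ> (*v) R) p - T_stencil \<alpha> \<beta> h a f (R *v p) = D h / h\<^sup>2" for h
    using T_stencil_eq_frame_sum[of h a R f p] T_stencil_eq_frame_sum[of h a "mat 1" f "R *v p"]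
    by (simp add: assms(1,2) D \<Phi>_def comp_def diff_divide_distrib)
  moreover have "(\<lambda>h. D h / h\<^sup>2) \<in> O[at_right 0](\<lambda>h. h ^ 5 / h\<^sup>2)"
    by (intro landau_o.big.divide_right D_small) (simp add: eventually_at_filter)
  \<comment> \<open>At \<open>h = 0\<close> both sides are \<open>0\<close> because \<open>x / 0 = 0\<close>.\<close>
  moreover have "(\<lambda>h::real. h ^ 5 / h\<^sup>2) = (\<lambda>h. h ^ 3)"
    by (simp add: fun_eq_iff eval_nat_numeral)
  ultimately show ?thesis by simp
qed

end
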